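(* For every infinite cardinal $\kappa$, the random algebra $\mathcal{B}_\kappa$ does not specialize trees of height $\omega_1$ without cofinal branches; that is, if $T$ is a non-special tree of height $\omega_1$ without cofinal branches, then $T$ is non-special in the generic extension $V[\mathcal{B}_\kappa]$.
   Context: A tree $(T,<_T)$ of height $\omega_1$ is \emph{special} if there is a function $f:T\to\omega$ such that $s<_T t$ implies $f(s)\neq f(t)$. Trees may have arbitrary size. A cofinal branch is a chain meeting every level of $T$. \emph{Random algebra.} For infinite $\kappa$, let $\Sigma_\kappa$ be the $\sigma$-algebra on $2^\kappa$ generated by the cylinder sets $S_t=\{f\in 2^\kappa : t\subseteq f\}$, for $t$ a finite partial function from $\kappa$ to $2$; let $\lambda_\kappa$ be the product probability measure on $\Sigma_\kappa$, with $\lambda_\kappa(S_t)=2^{-|t|}$; let $\mathscr{N}_\kappa$ be the ideal of $\lambda_\kappa$-null sets in $\Sigma_\kappa$. Then $\mathcal{B}_\kappa=\Sigma_\kappa/\mathscr{N}_\kappa$, a complete ccc Boolean algebra; as a forcing notion one uses its nonzero elements. *)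

theory Defs
  imports "HOL-Probability.Probability" "HOL-Library.Equipollence"
begin

section \<open>Trees of height $\omega_1$\<close>

text \<open>Ordinals are represented by well-orders up to isomorphism. The ordinals below
  \<open>omega1\<close> are the proper initial segments of the well-order \<open>omega1\<close>, and these are
  indexed by the elements of its field.\<close>

definition omega1 :: "nat set rel" where
  "omega1 = cardSuc natLeq"

definition omega1_seg :: "nat set \<Rightarrow> nat set rel" where
  "omega1_seg \<alpha> = Restr omega1 (underS omega1 \<alpha>)"

text \<open>A tree is given by its set of nodes \<open>T\<close> and its strict order \<open>lt\<close>; only the
  restriction of \<open>lt\<close> to \<open>T\<close> matters. The height of a node is the order type of
  \<open>pred_order\<close>, the reflexive order on its set of predecessors.\<close>

definition preds :: "'a set \<Rightarrow> ('a \<Rightarrow> 'a \<Rightarrow> bool) \<Rightarrow> 'a \<Rightarrow> 'a set" where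
  "preds T lt t = {s \<in> T. lt s t}"

definition pred_order :: "'a set \<Rightarrow> ('a \<Rightarrow> 'a \<Rightarrow> bool) \<Rightarrow> 'a \<Rightarrow> 'a rel" where
  "pred_order T lt t = {(x, y). x \<in> preds T lt t \<and> y \<in> preds T lt t \<and> (x = y \<or> lt x y)}"

definition is_tree :: "'a set \<Rightarrow> ('a \<Rightarrow> 'a \<Rightarrow> bool) \<Rightarrow> bool" where
  "is_tree T lt \<longleftrightarrow> irreflp_on T lt \<and> transp_on T lt \<and>
     (\<forall>t\<in>T. well_order_on (preds T lt t) (pred_order T lt t))"

definition level :: "'a set \<Rightarrow> ('a \<Rightarrow> 'a \<Rightarrow> bool) \<Rightarrow> nat set \<Rightarrow> 'a set" where
  "level T lt \<alpha> = {t \<in> T. (pred_order T lt t, omega1_seg \<alpha>) \<in> ordIso}"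

definition height_omega1 :: "'a set \<Rightarrow> ('a \<Rightarrow> 'a \<Rightarrow> bool) \<Rightarrow> bool" where
  "height_omega1 T lt \<longleftrightarrow>
     (\<forall>t\<in>T. (pred_order T lt t, omega1) \<in> ordLess) \<and>
     (\<forall>\<alpha>\<in>Field omega1. level T lt \<alpha> \<noteq> {})"

definition cofinal_branch :: "'a set \<Rightarrow> ('a \<Rightarrow> 'a \<Rightarrow> bool) \<Rightarrow> 'a set \<Rightarrow> bool" where
  "cofinal_branch T lt b \<longleftrightarrow> b \<subseteq> T \<and> (\<forall>s\<in>b. \<forall>t\<in>b. s = t \<or> lt s t \<or> lt t s) \<and>
     (\<forall>\<alpha>\<in>Field omega1. b \<inter> level T lt \<alpha> \<noteq> {})"

definition special :: "'a set \<Rightarrow> ('a \<Rightarrow> 'a \<Rightarrow> bool) \<Rightarrow> bool" where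
  "special T lt \<longleftrightarrow> (\<exists>f :: 'a \<Rightarrow> nat. \<forall>s\<in>T. \<forall>t\<in>T. lt s t \<longrightarrow> f s \<noteq> f t)"


section \<open>The random algebra\<close>

text \<open>The cardinal $\kappa$ is given by an infinite type \<open>'k\<close>, and $2^\kappa$ is the type
  \<open>'k \<Rightarrow> bool\<close>.\<close>

definition coin_measure :: "('k \<Rightarrow> bool) measure" where
  "coin_measure = PiM UNIV (\<lambda>_. measure_pmf (bernoulli_pmf (1/2)))"

lemma space_coin_measure [simp]: "space coin_measure = UNIV"
  by (simp add: coin_measure_def space_PiM)

lemma UNIV_coin_measure [simp]: "UNIV \<in> sets coin_measure"
  using sets.top[of coin_measure] by simp

lemma Compl_coin_measure [simp]: "A \<in> sets coin_measure \<Longrightarrow> - A \<in> sets coin_measure"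
  using sets.compl_sets[of A coin_measure] by (simp add: Compl_eq_Diff_UNIV)

lemma cylinder_coin_measure:
  fixes J :: "'k set" and t :: "'k \<Rightarrow> bool"
  assumes "finite J"
  shows "{f. \<forall>i\<in>J. f i = t i} \<in> sets (coin_measure :: ('k \<Rightarrow> bool) measure)" (is ?A)
    and "measure (coin_measure :: ('k \<Rightarrow> bool) measure) {f. \<forall>i\<in>J. f i = t i} = (1/2) ^ card J" (is ?B)
proof -
  interpret product_prob_space "\<lambda>_ :: 'k. measure_pmf (bernoulli_pmf (1/2))" "UNIV :: 'k set"
    by (simp add: product_prob_space_def product_sigma_finite_def product_prob_space_axioms_def
        measure_pmf.prob_space_axioms measure_pmf.sigma_finite_measure_axioms)
  have eq: "prod_emb UNIV (\<lambda>_ :: 'k. measure_pmf (bernoulli_pmf (1/2))) J (PiE J (\<lambda>i. {t i}))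
      = {f. \<forall>i\<in>J. f i = t i}"
    by (auto simp: prod_emb_def PiE_def Pi_def extensional_def fun_eq_iff)
  have "prod_emb UNIV (\<lambda>_ :: 'k. measure_pmf (bernoulli_pmf (1/2))) J (PiE J (\<lambda>i. {t i}))
      \<in> sets (coin_measure :: ('k \<Rightarrow> bool) measure)"
    unfolding coin_measure_def using assms by (intro sets_PiM_I) auto
  then show ?A using eq by simp
  have "measure (coin_measure :: ('k \<Rightarrow> bool) measure)
      (prod_emb UNIV (\<lambda>_ :: 'k. measure_pmf (bernoulli_pmf (1/2))) J (PiE J (\<lambda>i. {t i})))
      = (\<Prod>i\<in>J. measure (measure_pmf (bernoulli_pmf (1/2))) {t i})"
    unfolding coin_measure_def using assms by (intro measure_PiM_emb) auto
  also have "\<dots> = (\<Prod>i\<in>J. 1/2)"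
  proof (intro prod.cong refl)
    show "measure (measure_pmf (bernoulli_pmf (1/2))) {t i} = 1/2" for i
      by (cases "t i") (simp_all add: measure_pmf_single)
  qed
  finally show ?B using eq by simp
qed

definition null_eq :: "('k \<Rightarrow> bool) set \<Rightarrow> ('k \<Rightarrow> bool) set \<Rightarrow> bool" where
  "null_eq A B \<longleftrightarrow> A \<in> sets coin_measure \<and> B \<in> sets coin_measure \<and>
     (A - B) \<union> (B - A) \<in> null_sets coin_measure"

lemma null_eq_AE: "null_eq A B \<longleftrightarrow> A \<in> sets coin_measure \<and> B \<in> sets coin_measure \<and>
    (AE f in coin_measure. f \<in> A \<longleftrightarrow> f \<in> B)"
proof -
  have "(A - B) \<union> (B - A) \<in> null_sets coin_measure \<longleftrightarrow> (AE f in coin_measure. f \<in> A \<longleftrightarrow> f \<in> B)"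
    if "A \<in> sets coin_measure" "B \<in> sets coin_measure"
  proof -
    have "(A - B) \<union> (B - A) \<in> null_sets coin_measure
        \<longleftrightarrow> (AE f in coin_measure. f \<notin> (A - B) \<union> (B - A))"
      using that by (intro AE_iff_null_sets) auto
    also have "\<dots> \<longleftrightarrow> (AE f in coin_measure. f \<in> A \<longleftrightarrow> f \<in> B)"
      by (rule AE_cong) auto
    finally show ?thesis .
  qed
  then show ?thesis unfolding null_eq_def by blast
qed

lemma diff_null_AE:
  assumes "A \<in> sets coin_measure" "B \<in> sets coin_measure"
  shows "A - B \<in> null_sets coin_measure \<longleftrightarrow> (AE f in coin_measure. f \<in> A \<longrightarrow> f \<in> B)"
proof -
  have "A - B \<in> null_sets coin_measure \<longleftrightarrow> (AE f in coin_measure. f \<notin> A - B)"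
    using assms by (intro AE_iff_null_sets) auto
  also have "\<dots> \<longleftrightarrow> (AE f in coin_measure. f \<in> A \<longrightarrow> f \<in> B)"
    by (rule AE_cong) auto
  finally show ?thesis .
qed

lemma part_equivp_null_eq: "part_equivp null_eq"
proof (rule part_equivpI)
  show "\<exists>A :: ('k \<Rightarrow> bool) set. null_eq A A"
    by (rule exI[of _ "{}"]) (simp add: null_eq_AE)
  show "symp null_eq"
    by (simp add: symp_def null_eq_AE eq_commute)
  show "transp null_eq"
    by (rule transpI, simp add: null_eq_AE) (elim conjE, erule (1) eventually_elim2, blast)
qed

quotient_type 'k random_algebra = "('k \<Rightarrow> bool) set" / partial: null_eq
  by (rule part_equivp_null_eq)

instantiation random_algebra :: (type) boolean_algebra
begin

lift_definition inf_random_algebra ::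
  "'a random_algebra \<Rightarrow> 'a random_algebra \<Rightarrow> 'a random_algebra" is "(\<inter>)"
  unfolding null_eq_AE by (clarify, intro conjI) (simp, simp, erule (1) eventually_elim2, blast)

lift_definition sup_random_algebra ::
  "'a random_algebra \<Rightarrow> 'a random_algebra \<Rightarrow> 'a random_algebra" is "(\<union>)"
  unfolding null_eq_AE by (clarify, intro conjI) (simp, simp, erule (1) eventually_elim2, blast)

lift_definition minus_random_algebra ::
  "'a random_algebra \<Rightarrow> 'a random_algebra \<Rightarrow> 'a random_algebra" is "(-)"
  unfolding null_eq_AE by (clarify, intro conjI) (simp, simp, erule (1) eventually_elim2, blast)

lift_definition uminus_random_algebra :: "'a random_algebra \<Rightarrow> 'a random_algebra" is "\<lambda>A. - A"
  unfolding null_eq_AE by simp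

lift_definition bot_random_algebra :: "'a random_algebra" is "{}"
  unfolding null_eq_AE by simp

lift_definition top_random_algebra :: "'a random_algebra" is "UNIV"
  unfolding null_eq_AE by simp

lift_definition less_eq_random_algebra :: "'a random_algebra \<Rightarrow> 'a random_algebra \<Rightarrow> bool"
  is "\<lambda>A B. A - B \<in> null_sets coin_measure"
proof -
  fix A A' B B' :: "('a \<Rightarrow> bool) set"
  assume "null_eq A A'" "null_eq B B'"
  then have m: "A \<in> sets coin_measure" "A' \<in> sets coin_measure"
      "B \<in> sets coin_measure" "B' \<in> sets coin_measure"
    and ae: "AE f in coin_measure. f \<in> A \<longleftrightarrow> f \<in> A'" "AE f in coin_measure. f \<in> B \<longleftrightarrow> f \<in> B'"
    by (auto simp: null_eq_AE)
  from ae have "AE f in coin_measure. (f \<in> A \<longrightarrow> f \<in> B) \<longleftrightarrow> (f \<in> A' \<longrightarrow> f \<in> B')"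
    by eventually_elim blast
  then have "(AE f in coin_measure. f \<in> A \<longrightarrow> f \<in> B) \<longleftrightarrow> (AE f in coin_measure. f \<in> A' \<longrightarrow> f \<in> B')"
    by (rule eventually_subst)
  then show "(A - B \<in> null_sets coin_measure) = (A' - B' \<in> null_sets coin_measure)"
    using m by (simp add: diff_null_AE)
qed

definition less_random_algebra :: "'a random_algebra \<Rightarrow> 'a random_algebra \<Rightarrow> bool" where
  "less_random_algebra a b \<longleftrightarrow> a \<le> b \<and> \<not> b \<le> a"

instance
proof
  fix x y z :: "'a random_algebra"
  show "x < y \<longleftrightarrow> x \<le> y \<and> \<not> y \<le> x"
    by (rule less_random_algebra_def)
  show "x \<le> x"
    by transfer (simp add: null_eq_AE)
  show "x \<le> z" if "x \<le> y" "y \<le> z"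
    using that
    by (transfer, simp add: null_eq_AE diff_null_AE) (erule (1) eventually_elim2, blast)
  show "x = y" if "x \<le> y" "y \<le> x"
    using that
    by (transfer, simp add: null_eq_AE diff_null_AE) (erule (1) eventually_elim2, blast)
  show "inf x y \<le> x" "inf x y \<le> y"
    by (transfer; simp add: null_eq_AE diff_null_AE)+
  show "x \<le> inf y z" if "x \<le> y" "x \<le> z"
    using that
    by (transfer, simp add: null_eq_AE diff_null_AE) (erule (1) eventually_elim2, blast)
  show "x \<le> sup x y" "y \<le> sup x y"
    by (transfer; simp add: null_eq_AE diff_null_AE)+
  show "sup y z \<le> x" if "y \<le> x" "z \<le> x"
    using that by (transfer, simp add: Un_Diff null_sets.Un)
  show "bot \<le> x"
    by transfer simp
  show "x \<le> top"
    by transfer simp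
  show "sup x (inf y z) = inf (sup x y) (sup x z)"
    by transfer (simp add: null_eq_AE; blast)
  show "inf x (- x) = bot"
    by transfer (simp add: null_eq_AE; blast)
  show "sup x (- x) = top"
    by transfer (simp add: null_eq_AE)
  show "x - y = inf x (- y)"
    by transfer (simp add: null_eq_AE)
qed

end


section \<open>Sets of the ground model\<close>

text \<open>HOL has no cumulative hierarchy. Ground-model sets are well-founded trees:
  \<open>GEmpty\<close> is the empty set, \<open>GSet x\<close> stands for the nonempty set $\{x_i : i \in U\}$, where
  $U$ is the universe of \<open>'u\<close>, and \<open>gset_eq\<close> is extensional equality. The type \<open>'u\<close> of indices is arbitrary and only bounds the hereditary
  cardinality of the sets under consideration.\<close>

datatype 'u gset = GEmpty | GSet "'u \<Rightarrow> 'u gset"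

primrec gset_elems :: "'u gset \<Rightarrow> 'u gset set" where
  "gset_elems GEmpty = {}"
| "gset_elems (GSet x) = range x"

primrec gset_eq :: "'u gset \<Rightarrow> 'u gset \<Rightarrow> bool" where
  "gset_eq GEmpty y \<longleftrightarrow> gset_elems y = {}"
| "gset_eq (GSet x) y \<longleftrightarrow>
     (\<forall>i. \<exists>z\<in>gset_elems y. gset_eq (x i) z) \<and> (\<forall>z\<in>gset_elems y. \<exists>i. gset_eq (x i) z)"

text \<open>The ground-model set with the given elements, which exists as soon as there are at
  most \<open>|'u|\<close> of them.\<close>

definition gset_of :: "'u gset set \<Rightarrow> 'u gset" where
  "gset_of S = (SOME x. gset_elems x = S)"

lemma gset_elems_gset_of:
  assumes "S \<lesssim> (UNIV :: 'u set)"
  shows "gset_elems (gset_of (S :: 'u gset set)) = S"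
proof -
  have "\<exists>x :: 'u gset. gset_elems x = S"
  proof (cases "S = {}")
    case True
    then show ?thesis by (intro exI[of _ GEmpty]) simp
  next
    case False
    obtain f where "inj_on f S" "f ` S \<subseteq> (UNIV :: 'u set)"
      using assms unfolding lepoll_def by blast
    then obtain g :: "'u \<Rightarrow> 'u gset" where "range g = S"
      using inj_on_iff_surj[OF False, of "UNIV :: 'u set"] by blast
    then show ?thesis by (intro exI[of _ "GSet g"]) simp
  qed
  then show ?thesis
    unfolding gset_of_def by (rule someI_ex)
qed

definition gset_pair :: "'u gset \<Rightarrow> 'u gset \<Rightarrow> 'u gset" where
  "gset_pair x y = gset_of {gset_of {x}, gset_of {x, y}}"

primrec gset_nat :: "nat \<Rightarrow> 'u gset" where
  "gset_nat 0 = gset_of {}"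
| "gset_nat (Suc n) = gset_of (insert (gset_nat n) (gset_elems (gset_nat n)))"

definition gset_omega :: "'u gset" where
  "gset_omega = gset_of (range gset_nat)"

text \<open>A coding of the elements of a HOL set \<open>T\<close> by pairwise different ground-model sets; the
  cardinality condition makes \<open>T\<close> itself a ground-model set.\<close>

definition gset_coding :: "'a set \<Rightarrow> ('a \<Rightarrow> 'u gset) \<Rightarrow> bool" where
  "gset_coding T c \<longleftrightarrow> T \<lesssim> (UNIV :: 'u set) \<and> (\<forall>s\<in>T. \<forall>t\<in>T. gset_eq (c s) (c t) \<longrightarrow> s = t)"

lemma gset_eq_iff: "gset_eq x y \<longleftrightarrow>
    (\<forall>a\<in>gset_elems x. \<exists>b\<in>gset_elems y. gset_eq a b) \<and>
    (\<forall>b\<in>gset_elems y. \<exists>a\<in>gset_elems x. gset_eq a b)"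
  by (cases x) auto

lemma gset_eq_sym: "gset_eq x y \<longleftrightarrow> gset_eq y x"
proof (induction x arbitrary: y)
  case GEmpty
  show ?case by (cases y) auto
next
  case (GSet x)
  have IH: "gset_eq (x i) z \<longleftrightarrow> gset_eq z (x i)" for i z
    by (rule GSet.IH) auto
  show ?case
    by (cases y) (auto simp: IH)
qed

text \<open>Every tree admits a coding over every index type of sufficient size.\<close>

lemma ex_gset_coding:
  assumes "T \<lesssim> (UNIV :: 'u set)"
  shows "\<exists>c :: 'a \<Rightarrow> 'u gset. gset_coding (T :: 'a set) c"
proof -
  obtain r where "well_order_on (UNIV :: 'u set) r"
    using well_order_on by blast
  then have wf: "wf (r - Id)" and tot: "\<And>i j. i \<noteq> j \<Longrightarrow> (i, j) \<in> r - Id \<or> (j, i) \<in> r - Id"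
    by (auto simp: well_order_on_def linear_order_on_def total_on_def)
  define d :: "'u \<Rightarrow> 'u gset"
    where "d = wfrec (r - Id) (\<lambda>d i. gset_of (d ` {j. (j, i) \<in> r - Id}))"
  have d_rec: "d i = gset_of (d ` {j. (j, i) \<in> r - Id})" for i
  proof -
    have "d i = gset_of (cut d (r - Id) i ` {j. (j, i) \<in> r - Id})"
      unfolding d_def by (rule wfrec[OF wf])
    also have "cut d (r - Id) i ` {j. (j, i) \<in> r - Id} = d ` {j. (j, i) \<in> r - Id}"
      by (intro image_cong refl) (simp add: cut_apply)
    finally show ?thesis .
  qed
  have elems: "gset_elems (d i) = d ` {j. (j, i) \<in> r - Id}" for i
  proof -
    have "d ` {j. (j, i) \<in> r - Id} \<lesssim> {j. (j, i) \<in> r - Id}"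
      by (rule image_lepoll)
    also have "\<dots> \<lesssim> (UNIV :: 'u set)"
      by (rule subset_imp_lepoll) simp
    finally show ?thesis
      using gset_elems_gset_of d_rec[of i] by metis
  qed
  have less: "\<not> gset_eq (d i) (d j)" if "(i, j) \<in> r - Id" for i j
    using wf that
  proof (induction i arbitrary: j rule: wf_induct_rule)
    case (less i)
    show ?case
    proof
      assume eq: "gset_eq (d i) (d j)"
      have "d i \<in> gset_elems (d j)"
        unfolding elems using less.prems by (rule imageI[OF CollectI])
      then obtain a where "a \<in> gset_elems (d i)" "gset_eq a (d i)"
        using eq gset_eq_iff by blast
      then obtain k where "(k, i) \<in> r - Id" "gset_eq (d k) (d i)"
        unfolding elems by blast
      with less.IH show False by blast
    qed
  qed
  have inj: "i = j" if "gset_eq (d i) (d j)" for i j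
    using less tot gset_eq_sym that by metis
  obtain f :: "'a \<Rightarrow> 'u" where "inj_on f T"
    using assms unfolding lepoll_def by blast
  then have "gset_coding T (\<lambda>t. d (f t))"
    unfolding gset_coding_def using assms inj by (auto dest: inj_onD)
  then show ?thesis by blast
qed

definition gset_nodes :: "'a set \<Rightarrow> ('a \<Rightarrow> 'u gset) \<Rightarrow> 'u gset" where
  "gset_nodes T c = gset_of (c ` T)"

definition gset_order :: "'a set \<Rightarrow> ('a \<Rightarrow> 'a \<Rightarrow> bool) \<Rightarrow> ('a \<Rightarrow> 'u gset) \<Rightarrow> 'u gset" where
  "gset_order T lt c = gset_of {gset_pair (c s) (c t) | s t. s \<in> T \<and> t \<in> T \<and> lt s t}"


section \<open>Forcing with the nonzero elements of a Boolean algebra\<close>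

text \<open>\<open>NEmpty\<close> is the empty name, and \<open>Name x b\<close> is the name $\{(x_i, b_i) : i \in U\}$. An element with condition \<open>bot\<close>
  has no effect.\<close>

datatype ('u, 'b) name = NEmpty | Name "'u \<Rightarrow> ('u, 'b) name" "'u \<Rightarrow> 'b"

primrec name_elems :: "('u, 'b) name \<Rightarrow> (('u, 'b) name \<times> 'b) set" where
  "name_elems NEmpty = {}"
| "name_elems (Name x b) = range (\<lambda>i. (x i, b i))"

primrec check :: "'u gset \<Rightarrow> ('u, 'b :: boolean_algebra) name" where
  "check GEmpty = NEmpty"
| "check (GSet x) = Name (\<lambda>i. check (x i)) (\<lambda>_. top)"

text \<open>A sentence of the forcing language is identified with the predicate of being forced by a
  condition. Only its values at nonzero elements are relevant.\<close>

type_synonym 'b sentence = "'b \<Rightarrow> bool"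

definition dense_below :: "'b :: boolean_algebra \<Rightarrow> ('b \<Rightarrow> bool) \<Rightarrow> bool" where
  "dense_below p D \<longleftrightarrow> (\<forall>q. q \<noteq> bot \<and> q \<le> p \<longrightarrow> (\<exists>r. r \<noteq> bot \<and> r \<le> q \<and> D r))"

text \<open>The usual recursion: \<open>p\<close> forces $x = y$ if every \<open>q \<le> p\<close> below the condition of an
  element of one name forces that element to be in the other name, and \<open>p\<close> forces $x \in y$
  if the conditions \<open>r\<close> such that \<open>r \<le> d\<close> and \<open>r\<close> forces $x = z$ for some $(z, d) \in y$ are
  dense below \<open>p\<close>. Membership is unfolded in the clauses for equality; see \<open>fEq_iff\<close>.\<close>

primrec fEq :: "('u, 'b) name \<Rightarrow> ('u, 'b) name \<Rightarrow> ('b :: boolean_algebra) sentence"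
    (infix "\<^bold>=" 50) where
  "(NEmpty \<^bold>= y) = (\<lambda>p.
     \<forall>(z, d)\<in>name_elems y. \<forall>q. q \<noteq> bot \<and> q \<le> p \<and> q \<le> d \<longrightarrow> dense_below q (\<lambda>r. False))"
| "(Name x b \<^bold>= y) = (\<lambda>p.
     (\<forall>i. \<forall>q. q \<noteq> bot \<and> q \<le> p \<and> q \<le> b i \<longrightarrow>
        dense_below q (\<lambda>r. \<exists>(z, d)\<in>name_elems y. r \<le> d \<and> (x i \<^bold>= z) r)) \<and>
     (\<forall>(z, d)\<in>name_elems y. \<forall>q. q \<noteq> bot \<and> q \<le> p \<and> q \<le> d \<longrightarrow>
        dense_below q (\<lambda>r. \<exists>i. r \<le> b i \<and> (x i \<^bold>= z) r)))"

definition fMem :: "('u, 'b) name \<Rightarrow> ('u, 'b) name \<Rightarrow> ('b :: boolean_algebra) sentence"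
    (infix "\<^bold>\<in>" 50) where
  "(x \<^bold>\<in> y) = (\<lambda>p. dense_below p (\<lambda>r. \<exists>(z, d)\<in>name_elems y. r \<le> d \<and> (x \<^bold>= z) r))"

lemma fEq_sym: "(x \<^bold>= y) = (y \<^bold>= x)"
proof (induction x arbitrary: y)
  case NEmpty
  show ?case by (cases y) auto
next
  case (Name x b)
  have IH: "(x i \<^bold>= z) = (z \<^bold>= x i)" for i z
    by (rule Name.IH) auto
  show ?case
    by (cases y) (auto simp: IH fun_eq_iff)
qed

lemma fEq_iff: "(x \<^bold>= y) p \<longleftrightarrow>
    (\<forall>(z, d)\<in>name_elems x. \<forall>q. q \<noteq> bot \<and> q \<le> p \<and> q \<le> d \<longrightarrow> (z \<^bold>\<in> y) q) \<and>
    (\<forall>(z, d)\<in>name_elems y. \<forall>q. q \<noteq> bot \<and> q \<le> p \<and> q \<le> d \<longrightarrow> (z \<^bold>\<in> x) q)"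
proof (cases x)
  case NEmpty
  then show ?thesis by (auto simp: fMem_def)
next
  case (Name a b)
  show ?thesis
    unfolding Name fMem_def by (simp add: fEq_sym[of "a _"])
qed

definition fNot :: "('b :: boolean_algebra) sentence \<Rightarrow> 'b sentence" ("\<^bold>\<not> _" [40] 40) where
  "(\<^bold>\<not> \<phi>) = (\<lambda>p. \<forall>q. q \<noteq> bot \<and> q \<le> p \<longrightarrow> \<not> \<phi> q)"

definition fAnd :: "('b :: boolean_algebra) sentence \<Rightarrow> 'b sentence \<Rightarrow> 'b sentence"
    (infixr "\<^bold>\<and>" 35) where
  "(\<phi> \<^bold>\<and> \<psi>) = (\<lambda>p. \<phi> p \<and> \<psi> p)"

definition fAll :: "(('u, 'b) name \<Rightarrow> ('b :: boolean_algebra) sentence) \<Rightarrow> 'b sentence"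
    (binder "\<^bold>\<forall>" 10) where
  "(\<^bold>\<forall>x. \<phi> x) = (\<lambda>p. \<forall>x. \<phi> x p)"

abbreviation fOr :: "('b :: boolean_algebra) sentence \<Rightarrow> 'b sentence \<Rightarrow> 'b sentence"
    (infixr "\<^bold>\<or>" 30) where
  "\<phi> \<^bold>\<or> \<psi> \<equiv> \<^bold>\<not> (\<^bold>\<not> \<phi> \<^bold>\<and> \<^bold>\<not> \<psi>)"

abbreviation fImp :: "('b :: boolean_algebra) sentence \<Rightarrow> 'b sentence \<Rightarrow> 'b sentence"
    (infixr "\<^bold>\<longrightarrow>" 25) where
  "\<phi> \<^bold>\<longrightarrow> \<psi> \<equiv> \<^bold>\<not> (\<phi> \<^bold>\<and> \<^bold>\<not> \<psi>)"

abbreviation fIff :: "('b :: boolean_algebra) sentence \<Rightarrow> 'b sentence \<Rightarrow> 'b sentence"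
    (infixr "\<^bold>\<longleftrightarrow>" 25) where
  "\<phi> \<^bold>\<longleftrightarrow> \<psi> \<equiv> (\<phi> \<^bold>\<longrightarrow> \<psi>) \<^bold>\<and> (\<psi> \<^bold>\<longrightarrow> \<phi>)"

abbreviation fEx :: "(('u, 'b) name \<Rightarrow> ('b :: boolean_algebra) sentence) \<Rightarrow> 'b sentence"
    (binder "\<^bold>\<exists>" 10) where
  "\<^bold>\<exists>x. \<phi> x \<equiv> \<^bold>\<not> (\<^bold>\<forall>x. \<^bold>\<not> \<phi> x)"

text \<open>A sentence holds in the generic extension (for every generic filter) if it is forced by
  every condition.\<close>

definition forced :: "('b :: boolean_algebra) sentence \<Rightarrow> bool" where
  "forced \<phi> \<longleftrightarrow> (\<forall>p. p \<noteq> bot \<longrightarrow> \<phi> p)"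


section \<open>Specialness in the generic extension\<close>

definition fUpair ::
  "('u, 'b) name \<Rightarrow> ('u, 'b) name \<Rightarrow> ('u, 'b) name \<Rightarrow> ('b :: boolean_algebra) sentence" where
  "fUpair z x y = (\<^bold>\<forall>w. (w \<^bold>\<in> z) \<^bold>\<longleftrightarrow> (w \<^bold>= x) \<^bold>\<or> (w \<^bold>= y))"

definition fPair ::
  "('u, 'b) name \<Rightarrow> ('u, 'b) name \<Rightarrow> ('u, 'b) name \<Rightarrow> ('b :: boolean_algebra) sentence" where
  "fPair z x y = (\<^bold>\<exists>u. \<^bold>\<exists>v. fUpair u x x \<^bold>\<and> fUpair v x y \<^bold>\<and> fUpair z u v)"

definition fRel ::
  "('u, 'b) name \<Rightarrow> ('u, 'b) name \<Rightarrow> ('u, 'b) name \<Rightarrow> ('b :: boolean_algebra) sentence" where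
  "fRel R x y = (\<^bold>\<exists>z. fPair z x y \<^bold>\<and> (z \<^bold>\<in> R))"

definition fFun ::
  "('u, 'b) name \<Rightarrow> ('u, 'b) name \<Rightarrow> ('u, 'b) name \<Rightarrow> ('b :: boolean_algebra) sentence" where
  "fFun f A B =
     ((\<^bold>\<forall>z. (z \<^bold>\<in> f) \<^bold>\<longrightarrow> (\<^bold>\<exists>x. \<^bold>\<exists>y. (x \<^bold>\<in> A) \<^bold>\<and> (y \<^bold>\<in> B) \<^bold>\<and> fPair z x y)) \<^bold>\<and>
      (\<^bold>\<forall>x. (x \<^bold>\<in> A) \<^bold>\<longrightarrow> (\<^bold>\<exists>y. fRel f x y)) \<^bold>\<and>
      (\<^bold>\<forall>x. \<^bold>\<forall>y. \<^bold>\<forall>y'. fRel f x y \<^bold>\<and> fRel f x y' \<^bold>\<longrightarrow> (y \<^bold>= y')))"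

text \<open>The formula ``there is $f : T \to \omega$ such that $s <_T t$ implies $f(s) \neq f(t)$'',
  with the set of nodes \<open>T\<close>, the order \<open>R\<close> and the set \<open>W\<close> of natural numbers as parameters.
  For \<open>W\<close> one uses \<open>check gset_omega\<close>, as $\omega$ is absolute.\<close>

definition fSpecial ::
  "('u, 'b) name \<Rightarrow> ('u, 'b) name \<Rightarrow> ('u, 'b) name \<Rightarrow> ('b :: boolean_algebra) sentence" where
  "fSpecial T R W = (\<^bold>\<exists>f. fFun f T W \<^bold>\<and>
     (\<^bold>\<forall>s. \<^bold>\<forall>t. \<^bold>\<forall>m. \<^bold>\<forall>n. (s \<^bold>\<in> T) \<^bold>\<and> (t \<^bold>\<in> T) \<^bold>\<and> fRel R s t \<^bold>\<and> fRel f s m \<^bold>\<and> fRel f t n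
        \<^bold>\<longrightarrow> \<^bold>\<not> (m \<^bold>= n)))"

text \<open>The tree \<open>(T, lt)\<close>, coded by \<open>c\<close>, is non-special in the generic extension by the nonzero
  elements of \<open>'b\<close>. The type \<open>'u\<close> in the type of \<open>c\<close> bounds the size of the names.\<close>

definition forced_nonspecial ::
  "'b :: boolean_algebra itself \<Rightarrow> 'a set \<Rightarrow> ('a \<Rightarrow> 'a \<Rightarrow> bool) \<Rightarrow> ('a \<Rightarrow> 'u gset) \<Rightarrow> bool" where
  "forced_nonspecial _ T lt c \<longleftrightarrow>
     forced (\<^bold>\<not> (fSpecial (check (gset_nodes T c)) (check (gset_order T lt c)) (check gset_omega)
        :: 'b sentence))"

end

theory Submission
  imports Defs
begin

text \<open>Suppose a condition \<open>p\<close> forces \<open>f\<close> to be a specializing function. For every node \<open>t\<close> pick a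
  condition \<open>r t\<close> below \<open>p\<close> deciding the value \<open>f t\<close>, say as \<open>n t\<close>. If $s <_T t$ and \<open>n s = n t\<close>,
  then \<open>r s\<close> and \<open>r t\<close> are incompatible. Hence, among the nodes with a fixed value of \<open>n\<close> for which
  \<open>r t\<close> has measure greater than $1/k$, every node has fewer than \<open>k\<close> predecessors. Sending \<open>t\<close> to
  \<open>n t\<close>, a suitable \<open>k\<close> and the number of these predecessors specializes the tree in the ground
  model.\<close>

section \<open>The forcing relation\<close>

lemma dense_below_antimono: "dense_below p D \<Longrightarrow> q \<le> p \<Longrightarrow> dense_below q D"
  unfolding dense_below_def by (meson order_trans)

lemma dense_below_obtains:
  assumes "dense_below p D" "p \<noteq> bot"
  obtains r where "r \<noteq> bot" "r \<le> p" "D r"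
  using assms unfolding dense_below_def by blast

text \<open>Two refinements in a row: a condition is first strengthened into \<open>D\<close>, then
  into \<open>E\<close>. Nested density statements are flattened this way.\<close>

lemma dense_below_bind:
  assumes "dense_below p D" "\<And>q. q \<noteq> bot \<Longrightarrow> q \<le> p \<Longrightarrow> D q \<Longrightarrow> dense_below q E"
  shows "dense_below p E"
  unfolding dense_below_def
proof (intro allI impI)
  fix q assume "q \<noteq> bot \<and> q \<le> p"
  then obtain r where r: "r \<noteq> bot" "r \<le> q" "D r" "r \<le> p"
    using assms(1) unfolding dense_below_def by (meson order_trans)
  then obtain s where "s \<noteq> bot" "s \<le> r" "E s"
    using assms(2) unfolding dense_below_def by blast
  with r show "\<exists>r. r \<noteq> bot \<and> r \<le> q \<and> E r" by (meson order_trans)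
qed

lemma dense_belowI: "(\<And>q. q \<noteq> bot \<Longrightarrow> q \<le> p \<Longrightarrow> D q) \<Longrightarrow> dense_below p D"
  unfolding dense_below_def by blast

section \<open>Atomic sentences under passage to stronger conditions\<close>

lemma fEq_antimono: "(x \<^bold>= y) p \<Longrightarrow> q \<le> p \<Longrightarrow> (x \<^bold>= y) q"
  unfolding fEq_iff[of x y] by (fast intro: order_trans)

lemma fMem_antimono: "(x \<^bold>\<in> y) p \<Longrightarrow> q \<le> p \<Longrightarrow> (x \<^bold>\<in> y) q"
  unfolding fMem_def by (rule dense_below_antimono)

lemma fNot_antimono: "(\<^bold>\<not> \<phi>) p \<Longrightarrow> q \<le> p \<Longrightarrow> (\<^bold>\<not> \<phi>) q"
  unfolding fNot_def by (meson order_trans)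

text \<open>Membership is itself a density statement, so density of density collapses.\<close>

lemma fMem_denseI: "dense_below p (x \<^bold>\<in> y) \<Longrightarrow> (x \<^bold>\<in> y) p"
  unfolding fMem_def by (erule dense_below_bind) simp

lemma fMemI: "(z, d) \<in> name_elems y \<Longrightarrow> p \<le> d \<Longrightarrow> (x \<^bold>= z) p \<Longrightarrow> (x \<^bold>\<in> y) p"
  unfolding fMem_def by (rule dense_belowI) (blast intro: fEq_antimono order_trans)

lemma name_elems_induct:
  assumes "\<And>x. (\<And>z d. (z, d) \<in> name_elems x \<Longrightarrow> P z) \<Longrightarrow> P x"
  shows "P x"
  by (induction x; rule assms) auto

lemma fEqI:
  assumes "\<And>z d q. (z, d) \<in> name_elems x \<Longrightarrow> q \<noteq> bot \<Longrightarrow> q \<le> p \<Longrightarrow> q \<le> d \<Longrightarrow> (z \<^bold>\<in> y) q"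
    and "\<And>z d q. (z, d) \<in> name_elems y \<Longrightarrow> q \<noteq> bot \<Longrightarrow> q \<le> p \<Longrightarrow> q \<le> d \<Longrightarrow> (z \<^bold>\<in> x) q"
  shows "(x \<^bold>= y) p"
  unfolding fEq_iff[of x] using assms by blast

lemma fEqD1:
  "(x \<^bold>= y) p \<Longrightarrow> (z, d) \<in> name_elems x \<Longrightarrow> q \<noteq> bot \<Longrightarrow> q \<le> p \<Longrightarrow> q \<le> d \<Longrightarrow> (z \<^bold>\<in> y) q"
  unfolding fEq_iff[of x] by blast

text \<open>Because the goal is closed under density, one may pass to conditions at which
  \<open>x\<close> equals a specific element \<open>z\<close> of \<open>y\<close>.\<close>

lemma fMem_bind:
  assumes "(x \<^bold>\<in> y) p"
    and "\<And>z d q. (z, d) \<in> name_elems y \<Longrightarrow> q \<noteq> bot \<Longrightarrow> q \<le> p \<Longrightarrow> q \<le> d \<Longrightarrow> (x \<^bold>= z) q \<Longrightarrow> (x' \<^bold>\<in> y') q"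
  shows "(x' \<^bold>\<in> y') p"
proof (rule fMem_denseI)
  show "dense_below p (x' \<^bold>\<in> y')"
    using assms(1) unfolding fMem_def[of x]
  proof (rule dense_below_bind)
    fix q assume "q \<noteq> bot" "q \<le> p" "\<exists>(z, d)\<in>name_elems y. q \<le> d \<and> (x \<^bold>= z) q"
    then have "(x' \<^bold>\<in> y') q" using assms(2) by blast
    then show "dense_below q (x' \<^bold>\<in> y')" by (intro dense_belowI) (rule fMem_antimono)
  qed
qed

section \<open>Forced equality as an equivalence relation and a congruence for membership\<close>

lemma fEq_refl: "(x \<^bold>= x) p"
proof (induction x arbitrary: p rule: name_elems_induct)
  case (1 x)
  have "(z \<^bold>\<in> x) q" if "(z, d) \<in> name_elems x" "q \<le> d" for z d q
    using that(1,2) 1[OF that(1)] by (rule fMemI)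
  then show ?case by (intro fEqI)
qed

lemma fEq_trans: "(x \<^bold>= y) p \<Longrightarrow> (y \<^bold>= z) p \<Longrightarrow> (x \<^bold>= z) p"
proof (induction x arbitrary: y z p rule: name_elems_induct)
  case (1 x)
  note IH = 1(1) and xy = 1(2) and yz = 1(3)
  show ?case
  proof (rule fEqI)
    fix a d q assume a: "(a, d) \<in> name_elems x" and q: "q \<noteq> bot" "q \<le> p" "q \<le> d"
    from fEqD1[OF xy a q] show "(a \<^bold>\<in> z) q"
    proof (rule fMem_bind)
      fix b e r assume b: "(b, e) \<in> name_elems y" "r \<noteq> bot" "r \<le> q" "r \<le> e" "(a \<^bold>= b) r"
      then have "(b \<^bold>\<in> z) r"
        using fEqD1[OF yz] q by (meson order_trans)
      then show "(a \<^bold>\<in> z) r"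
        by (rule fMem_bind) (use fMemI IH[OF a] fEq_antimono[OF b(5)] in blast)
    qed
  next
    fix c d q assume c: "(c, d) \<in> name_elems z" and q: "q \<noteq> bot" "q \<le> p" "q \<le> d"
    from fEqD1[OF yz[unfolded fEq_sym[of y]] c q] show "(c \<^bold>\<in> x) q"
    proof (rule fMem_bind)
      fix b e r assume b: "(b, e) \<in> name_elems y" "r \<noteq> bot" "r \<le> q" "r \<le> e" "(c \<^bold>= b) r"
      then have "(b \<^bold>\<in> x) r"
        using fEqD1[OF xy[unfolded fEq_sym[of x]]] q by (meson order_trans)
      then show "(c \<^bold>\<in> x) r"
      proof (rule fMem_bind)
        fix a i s assume a: "(a, i) \<in> name_elems x" "s \<noteq> bot" "s \<le> r" "s \<le> i" "(b \<^bold>= a) s"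
        \<comment> \<open>The induction hypothesis concerns elements of \<open>x\<close> on the
          left, so the chain \<open>c\<close>, \<open>b\<close>, \<open>a\<close> is read backwards
          by symmetry.\<close>
        have "(a \<^bold>= c) s"
          using IH[OF a(1)] a(5) fEq_antimono[OF b(5) a(3)] unfolding fEq_sym[of c] fEq_sym[of b a]
          by blast
        with a show "(c \<^bold>\<in> x) s" by (simp add: fMemI fEq_sym)
      qed
    qed
  qed
qed

lemma fMem_cong_left:
  assumes "(x \<^bold>= y) p" "(y \<^bold>\<in> z) p"
  shows "(x \<^bold>\<in> z) p"
  using assms(2) by (rule fMem_bind) (use fMemI fEq_trans fEq_antimono[OF assms(1)] in blast)

lemma fMem_cong_right:
  assumes "(x \<^bold>\<in> y) p" "(y \<^bold>= z) p"
  shows "(x \<^bold>\<in> z) p"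
  using assms(1) by (rule fMem_bind) (use fMem_cong_left fEqD1[OF assms(2)] in blast)

section \<open>Connectives and quantifiers as statements about density\<close>

lemma fAnd_iff: "(\<phi> \<^bold>\<and> \<psi>) p \<longleftrightarrow> \<phi> p \<and> \<psi> p"
  by (simp add: fAnd_def)

lemma fAll_iff: "(\<^bold>\<forall>x. \<phi> x) p \<longleftrightarrow> (\<forall>x. \<phi> x p)"
  by (simp add: fAll_def)

text \<open>The witness may vary with the condition, so each use of an existential costs a
  strengthening.\<close>

lemma fEx_iff: "(\<^bold>\<exists>x. \<phi> x) p \<longleftrightarrow> dense_below p (\<lambda>q. \<exists>x. \<phi> x q)"
  unfolding fNot_def fAll_def dense_below_def by blast

lemma fOr_iff: "(\<phi> \<^bold>\<or> \<psi>) p \<longleftrightarrow> dense_below p (\<lambda>q. \<phi> q \<or> \<psi> q)"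
  unfolding fNot_def fAnd_def dense_below_def by blast

text \<open>Since \<open>\<psi>\<close> is an arbitrary predicate of conditions, the double negation
  yields it only at some stronger \<open>r\<close>, not at \<open>q\<close> itself.\<close>

lemma fImp_iff:
  "(\<phi> \<^bold>\<longrightarrow> \<psi>) p \<longleftrightarrow> (\<forall>q. q \<noteq> bot \<and> q \<le> p \<and> \<phi> q \<longrightarrow> (\<exists>r. r \<noteq> bot \<and> r \<le> q \<and> \<psi> r))"
  unfolding fNot_def fAnd_def by blast

lemma fImpI: "(\<And>q. q \<noteq> bot \<Longrightarrow> q \<le> p \<Longrightarrow> \<phi> q \<Longrightarrow> \<psi> q) \<Longrightarrow> (\<phi> \<^bold>\<longrightarrow> \<psi>) p"
  unfolding fImp_iff by blast

lemma fImp_obtains: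
  assumes "(\<phi> \<^bold>\<longrightarrow> \<psi>) p" "q \<noteq> bot" "q \<le> p" "\<phi> q"
  obtains r where "r \<noteq> bot" "r \<le> q" "\<psi> r"
  using assms unfolding fImp_iff by blast

lemma fEx_obtains:
  assumes "(\<^bold>\<exists>x. \<phi> x) p" "p \<noteq> bot"
  obtains r x where "r \<noteq> bot" "r \<le> p" "\<phi> x r"
  using assms unfolding fEx_iff by (blast elim: dense_below_obtains)

section \<open>Unordered and ordered pairs in the forcing language\<close>

lemma fUpair_iff: "fUpair z x y p \<longleftrightarrow>
    (\<forall>w. ((w \<^bold>\<in> z) \<^bold>\<longrightarrow> (w \<^bold>= x) \<^bold>\<or> (w \<^bold>= y)) p \<and> ((w \<^bold>= x) \<^bold>\<or> (w \<^bold>= y) \<^bold>\<longrightarrow> (w \<^bold>\<in> z)) p)"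
  unfolding fUpair_def fAll_iff fAnd_iff ..

lemma fUpair_mem:
  assumes "fUpair z x y p"
  shows "(x \<^bold>\<in> z) p" "(y \<^bold>\<in> z) p"
proof -
  have "(w \<^bold>\<in> z) p" if w: "w = x \<or> w = y" for w
  proof (rule fMem_denseI)
    have imp: "((w \<^bold>= x) \<^bold>\<or> (w \<^bold>= y) \<^bold>\<longrightarrow> (w \<^bold>\<in> z)) p"
      using assms unfolding fUpair_iff by blast
    \<comment> \<open>Reflexivity forces the disjunction everywhere; the implication then gives
      membership densely, hence outright.\<close>
    have "((w \<^bold>= x) \<^bold>\<or> (w \<^bold>= y)) q" for q
      using w fEq_refl unfolding fOr_iff by (blast intro: dense_belowI)
    then show "dense_below p (w \<^bold>\<in> z)"
      unfolding dense_below_def using fImp_obtains[OF imp] by metis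
  qed
  then show "(x \<^bold>\<in> z) p" "(y \<^bold>\<in> z) p" by blast+
qed

lemma fUpair_cases:
  assumes "fUpair z x y p" "(w \<^bold>\<in> z) p" "p \<noteq> bot"
  obtains r where "r \<noteq> bot" "r \<le> p" "(w \<^bold>= x) r \<or> (w \<^bold>= y) r"
proof -
  have imp: "((w \<^bold>\<in> z) \<^bold>\<longrightarrow> (w \<^bold>= x) \<^bold>\<or> (w \<^bold>= y)) p"
    using assms(1) unfolding fUpair_iff by blast
  obtain r where r: "r \<noteq> bot" "r \<le> p" "((w \<^bold>= x) \<^bold>\<or> (w \<^bold>= y)) r"
    using fImp_obtains[OF imp assms(3) order_refl assms(2)] .
  from r(3,1) obtain s where "s \<noteq> bot" "s \<le> r" "(w \<^bold>= x) s \<or> (w \<^bold>= y) s"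
    unfolding fOr_iff by (rule dense_below_obtains)
  with that r show thesis by (meson order_trans)
qed

lemma fUpair_antimono: "fUpair z x y p \<Longrightarrow> q \<le> p \<Longrightarrow> fUpair z x y q"
  unfolding fUpair_iff using fNot_antimono by blast

text \<open>An existential is outermost a negation, and negations persist to stronger conditions
  whatever they negate.\<close>

lemma fPair_antimono: "fPair z x y p \<Longrightarrow> q \<le> p \<Longrightarrow> fPair z x y q"
  unfolding fPair_def by (rule fNot_antimono)

lemma fRel_antimono: "fRel R x y p \<Longrightarrow> q \<le> p \<Longrightarrow> fRel R x y q"
  unfolding fRel_def by (rule fNot_antimono)

lemma fPair_obtains:
  assumes "fPair z x y p" "p \<noteq> bot"
  obtains q u v where "q \<noteq> bot" "q \<le> p" "fUpair u x x q" "fUpair v x y q" "fUpair z u v q"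
proof -
  from assms obtain q u where q: "q \<noteq> bot" "q \<le> p"
    and ex: "(\<^bold>\<exists>v. fUpair u x x \<^bold>\<and> fUpair v x y \<^bold>\<and> fUpair z u v) q"
    unfolding fPair_def by (rule fEx_obtains)
  obtain r v where r: "r \<noteq> bot" "r \<le> q"
    and "(fUpair u x x \<^bold>\<and> fUpair v x y \<^bold>\<and> fUpair z u v) r"
    using fEx_obtains[OF ex q(1)] .
  then show thesis
    unfolding fAnd_iff using that[OF r(1) order_trans[OF r(2) q(2)]] by blast
qed

lemma fRel_obtains:
  assumes "fRel R x y p" "p \<noteq> bot"
  obtains q z where "q \<noteq> bot" "q \<le> p" "fPair z x y q" "(z \<^bold>\<in> R) q"
proof -
  obtain q z where "q \<noteq> bot" "q \<le> p" "(fPair z x y \<^bold>\<and> (z \<^bold>\<in> R)) q"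
    using fEx_obtains[OF assms[unfolded fRel_def]] .
  then show thesis unfolding fAnd_iff by (blast intro: that)
qed

text \<open>The sentences are decided one at a time; persistence keeps the earlier decisions valid
  at the later, stronger conditions.\<close>

lemma decide_finite:
  fixes p :: "'b :: boolean_algebra" and \<Phi> :: "'b sentence set"
  assumes "finite \<Phi>" "p \<noteq> bot" "\<And>\<phi> q r. \<phi> \<in> \<Phi> \<Longrightarrow> \<phi> q \<Longrightarrow> r \<le> q \<Longrightarrow> \<phi> r"
  shows "\<exists>r. r \<noteq> bot \<and> r \<le> p \<and> (\<forall>\<phi>\<in>\<Phi>. \<phi> r \<or> (\<^bold>\<not> \<phi>) r)"
  using assms(1,3)
proof (induction \<Phi> rule: finite_induct)
  case empty
  show ?case using assms(2) by blast
next
  case (insert \<psi> \<Phi>)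
  from insert.IH insert.prems
  obtain r where r: "r \<noteq> bot" "r \<le> p" "\<forall>\<phi>\<in>\<Phi>. \<phi> r \<or> (\<^bold>\<not> \<phi>) r"
    by (metis insertCI)
  obtain q where q: "q \<noteq> bot" "q \<le> r" "\<psi> q \<or> (\<^bold>\<not> \<psi>) q"
    using r(1) unfolding fNot_def by blast
  have "\<phi> q \<or> (\<^bold>\<not> \<phi>) q" if "\<phi> \<in> insert \<psi> \<Phi>" for \<phi>
    using that q r(3) insert.prems[OF that] by (blast intro: fNot_antimono)
  moreover have "q \<le> p" using q(2) r(2) by (rule order_trans)
  ultimately show ?case using q(1) by blast
qed

text \<open>Below a condition that decides the equality of all the names involved, the usual argument
  for Kuratowski pairs can be carried out in the metalanguage.\<close>

lemma fPair_inject_right: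
  fixes p :: "'b :: boolean_algebra"
  assumes "fPair z x y p" "fPair z x' y' p" "p \<noteq> bot"
  obtains r where "r \<noteq> bot" "r \<le> p" "(y \<^bold>= y') r"
proof -
  obtain q u v where q: "q \<noteq> bot" "q \<le> p" and uv: "fUpair u x x q" "fUpair v x y q" "fUpair z u v q"
    using assms fPair_obtains by blast
  obtain q' u' v' where q': "q' \<noteq> bot" "q' \<le> q"
    and uv': "fUpair u' x' x' q'" "fUpair v' x' y' q'" "fUpair z u' v' q'"
    using assms q fPair_antimono fPair_obtains by metis
  \<comment> \<open>The components of both pairs, and the singletons and doubletons of their
    Kuratowski codes.\<close>
  define N where "N = {x, y, x', y', u, v, u', v'}"
  have "\<exists>r. r \<noteq> bot \<and> r \<le> q' \<and> (\<forall>\<phi>\<in>(\<lambda>(a, b). a \<^bold>= b) ` (N \<times> N). \<phi> r \<or> (\<^bold>\<not> \<phi>) r)"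
    using q'(1) by (intro decide_finite) (auto simp: N_def dest: fEq_antimono)
  then obtain r where r: "r \<noteq> bot" "r \<le> q'"
    and decided: "\<forall>a\<in>N. \<forall>b\<in>N. (a \<^bold>= b) r \<or> (\<^bold>\<not> (a \<^bold>= b)) r"
    by auto
  \<comment> \<open>An equality true at some stronger condition cannot have been decided negatively
    at \<open>r\<close>, so it already holds at \<open>r\<close>.\<close>
  have dec: "(a \<^bold>= b) r" if "a \<in> N" "b \<in> N" "s \<noteq> bot" "s \<le> r" "(a \<^bold>= b) s" for a b s
    using decided that unfolding fNot_def by blast
  have cases: "(w \<^bold>= b) r \<or> (w \<^bold>= c) r"
    if "fUpair a b c r" "(w \<^bold>\<in> a) r" "b \<in> N" "c \<in> N" "w \<in> N" for a b c w
    using fUpair_cases[OF that(1,2) r(1)] dec that(3-) by metis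
  have up: "fUpair u x x r" "fUpair v x y r" "fUpair z u v r"
      "fUpair u' x' x' r" "fUpair v' x' y' r" "fUpair z u' v' r"
    using uv uv' q' r by (meson fUpair_antimono order_trans)+
  have N: "x \<in> N" "y \<in> N" "x' \<in> N" "y' \<in> N" "u \<in> N" "v \<in> N" "u' \<in> N" "v' \<in> N"
    by (simp_all add: N_def)
  have sym: "(a \<^bold>= b) r \<Longrightarrow> (b \<^bold>= a) r" for a b
    by (simp add: fEq_sym)
  have c1: "(w \<^bold>\<in> u) r \<Longrightarrow> w \<in> N \<Longrightarrow> (w \<^bold>= x) r" for w
    using cases[OF up(1)] N by blast
  have c1': "(w \<^bold>\<in> u') r \<Longrightarrow> w \<in> N \<Longrightarrow> (w \<^bold>= x') r" for w
    using cases[OF up(4)] N by blast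
  have c2: "(w \<^bold>\<in> v) r \<Longrightarrow> w \<in> N \<Longrightarrow> (w \<^bold>= x) r \<or> (w \<^bold>= y) r" for w
    using cases[OF up(2)] N by blast
  have c2': "(w \<^bold>\<in> v') r \<Longrightarrow> w \<in> N \<Longrightarrow> (w \<^bold>= x') r \<or> (w \<^bold>= y') r" for w
    using cases[OF up(5)] N by blast
  \<comment> \<open>Both \<open>{u, v}\<close> and \<open>{u', v'}\<close> are the set
    \<open>z\<close>, so each code set equals one on the other side.\<close>
  have "(u \<^bold>= u') r \<or> (u \<^bold>= v') r" "(v \<^bold>= u') r \<or> (v \<^bold>= v') r" "(v' \<^bold>= u) r \<or> (v' \<^bold>= v) r"
    using cases[OF up(6) up(3)[THEN fUpair_mem(1)]] cases[OF up(6) up(3)[THEN fUpair_mem(2)]]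
      cases[OF up(3) up(6)[THEN fUpair_mem(2)]] N by blast+
  moreover have "(x' \<^bold>\<in> u') r" "(x' \<^bold>\<in> v') r" "(y \<^bold>\<in> v) r" "(y' \<^bold>\<in> v') r"
    using fUpair_mem up by blast+
  ultimately have "(x' \<^bold>\<in> u) r" "(y \<^bold>\<in> u') r \<or> (y \<^bold>\<in> v') r" "(y' \<^bold>\<in> u) r \<or> (y' \<^bold>\<in> v) r"
    using fMem_cong_right sym by blast+
  then have "(x' \<^bold>= x) r" "(y \<^bold>= x') r \<or> (y \<^bold>= y') r" "(y' \<^bold>= x) r \<or> (y' \<^bold>= y) r"
    using c1 c1' c2 c2' N by blast+
  \<comment> \<open>If neither alternative gives the claim directly, then \<open>y = x'\<close> and
    \<open>y' = x\<close>, and \<open>x' = x\<close> links them.\<close>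
  then have "(y \<^bold>= y') r"
    using sym fEq_trans by blast
  moreover have "r \<le> p"
    using order_trans[OF r(2) order_trans[OF q'(2) q(2)]] .
  ultimately show thesis
    by (intro that[OF r(1)])
qed


section \<open>Names for ground-model sets\<close>

lemma name_elems_check: "name_elems (check x) = (\<lambda>z. (check z, top)) ` gset_elems x"
  by (cases x) auto

lemma fMem_check_iff: "(w \<^bold>\<in> check x) p \<longleftrightarrow> dense_below p (\<lambda>r. \<exists>z\<in>gset_elems x. (w \<^bold>= check z) r)"
  unfolding fMem_def name_elems_check by simp

lemma check_fMem_check: "z \<in> gset_elems x \<Longrightarrow> (check z \<^bold>\<in> check x) p"
  unfolding fMem_check_iff by (blast intro: dense_belowI fEq_refl)

text \<open>\<open>gset_of\<close> is meaningful only for sets of size at most that of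
  \<open>'u\<close>; this bound covers pairs and omega.\<close>

lemma countable_lepoll_infinite: "countable S \<Longrightarrow> infinite A \<Longrightarrow> S \<lesssim> A"
  unfolding infinite_le_lepoll by (rule lepoll_trans) (auto simp: countable_def lepoll_def)

lemma infinite_times_self_lepoll: "infinite A \<Longrightarrow> A \<times> A \<lesssim> A"
  by (rule eqpoll_imp_lepoll) (simp add: eqpoll_def card_of_ordIso card_of_Times_same_infinite)

lemma fUpair_check:
  assumes "infinite (UNIV :: 'u set)"
  shows "fUpair (check (gset_of {a, b :: 'u gset})) (check a) (check b) p"
proof -
  have "gset_elems (gset_of {a, b}) = {a, b}"
    using assms by (intro gset_elems_gset_of countable_lepoll_infinite) auto
  \<comment> \<open>Both sides unfold to the same density statement, which makes the two
    implications of \<open>fUpair\<close> trivial.\<close>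
  then have mem: "(w \<^bold>\<in> check (gset_of {a, b})) q \<longleftrightarrow> ((w \<^bold>= check a) \<^bold>\<or> (w \<^bold>= check b)) q" for w q
    unfolding fOr_iff fMem_check_iff by simp
  show ?thesis
    unfolding fUpair_iff by (intro allI conjI; rule fImpI) (simp_all only: mem)
qed

lemma fPair_check:
  assumes "infinite (UNIV :: 'u set)"
  shows "fPair (check (gset_pair a b)) (check a) (check (b :: 'u gset)) p"
proof -
  have "fUpair (check (gset_of {a})) (check a) (check a) q" for q
    using fUpair_check[OF assms, of a a] by simp
  then show ?thesis
    unfolding fPair_def fEx_iff fAnd_iff gset_pair_def
    using fUpair_check[OF assms] by (intro dense_belowI exI conjI) auto
qed

lemma gset_elems_omega:
  assumes "infinite (UNIV :: 'u set)"
  shows "gset_elems (gset_omega :: 'u gset) = range gset_nat"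
  unfolding gset_omega_def
  by (intro gset_elems_gset_of countable_lepoll_infinite assms) simp

lemma gset_elems_nodes: "T \<lesssim> (UNIV :: 'u set) \<Longrightarrow> gset_elems (gset_nodes T c :: 'u gset) = c ` T"
  unfolding gset_nodes_def by (intro gset_elems_gset_of) (meson image_lepoll lepoll_trans)

text \<open>The order has at most as many pairs as \<open>T \<times> T\<close>, which still embeds
  into the infinite type \<open>'u\<close>.\<close>

lemma gset_elems_order:
  assumes "infinite (UNIV :: 'u set)" "T \<lesssim> (UNIV :: 'u set)"
  shows "gset_elems (gset_order T lt c :: 'u gset) = {gset_pair (c s) (c t) | s t. s \<in> T \<and> t \<in> T \<and> lt s t}"
  unfolding gset_order_def
proof (rule gset_elems_gset_of)
  have "{gset_pair (c s) (c t) | s t. s \<in> T \<and> t \<in> T \<and> lt s t}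
      \<subseteq> (\<lambda>(s, t). gset_pair (c s) (c t)) ` (T \<times> T)" by auto
  then have "{gset_pair (c s) (c t) | s t. s \<in> T \<and> t \<in> T \<and> lt s t} \<lesssim> T \<times> T"
    by (meson image_lepoll lepoll_trans subset_imp_lepoll)
  also have "T \<times> T \<lesssim> (UNIV :: 'u set) \<times> (UNIV :: 'u set)"
    using assms(2) by (intro times_lepoll_mono)
  also have "(UNIV :: 'u set) \<times> (UNIV :: 'u set) \<lesssim> (UNIV :: 'u set)"
    by (intro infinite_times_self_lepoll assms)
  finally show "{gset_pair (c s) (c t) | s t. s \<in> T \<and> t \<in> T \<and> lt s t} \<lesssim> (UNIV :: 'u set)" .
qed

lemma fRel_order_check:
  fixes c :: "'a \<Rightarrow> 'u gset"
  assumes "infinite (UNIV :: 'u set)" "T \<lesssim> (UNIV :: 'u set)" "s \<in> T" "t \<in> T" "lt s t"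
  shows "fRel (check (gset_order T lt c)) (check (c s)) (check (c t)) p"
proof -
  have "(check (gset_pair (c s) (c t)) \<^bold>\<in> check (gset_order T lt c)) q" for q
    using assms by (intro check_fMem_check) (auto simp: gset_elems_order)
  then show ?thesis
    unfolding fRel_def fEx_iff fAnd_iff
    using fPair_check[OF assms(1)] by (blast intro: dense_belowI)
qed


section \<open>Conditions deciding a specializing function\<close>

text \<open>Totality supplies a value \<open>y\<close>, and the graph clause only some pair
  \<open>(x', y')\<close> with the same code and \<open>y'\<close> in omega. Injectivity of pairs
  identifies \<open>y\<close> with \<open>y'\<close>, and membership in a check name is decided by
  strengthening.\<close>

lemma fFun_check_omega_decide:
  fixes f :: "('u, 'b :: boolean_algebra) name"
  assumes "infinite (UNIV :: 'u set)" "fFun f A (check gset_omega) p" "p \<noteq> bot" "(x \<^bold>\<in> A) p"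
  obtains r n y where "r \<noteq> bot" "r \<le> p" "fRel f x y r" "(y \<^bold>= check (gset_nat n)) r"
proof -
  from assms(2)
  have graph: "\<And>z. ((z \<^bold>\<in> f) \<^bold>\<longrightarrow> (\<^bold>\<exists>x. \<^bold>\<exists>y. (x \<^bold>\<in> A) \<^bold>\<and> (y \<^bold>\<in> check gset_omega) \<^bold>\<and> fPair z x y)) p"
    and total: "((x \<^bold>\<in> A) \<^bold>\<longrightarrow> (\<^bold>\<exists>y. fRel f x y)) p"
    unfolding fFun_def fAnd_iff fAll_iff by blast+
  obtain p1 where p1: "p1 \<noteq> bot" "p1 \<le> p" "(\<^bold>\<exists>y. fRel f x y) p1"
    using fImp_obtains[OF total assms(3) order_refl assms(4)] .
  obtain p2 y where p2: "p2 \<noteq> bot" "p2 \<le> p1" "fRel f x y p2"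
    using fEx_obtains[OF p1(3,1)] .
  obtain p3 z where p3: "p3 \<noteq> bot" "p3 \<le> p2" "fPair z x y p3" "(z \<^bold>\<in> f) p3"
    using fRel_obtains[OF p2(3,1)] .
  have "p3 \<le> p" using p1 p2 p3 by (meson order_trans)
  obtain p4 where p4: "p4 \<noteq> bot" "p4 \<le> p3"
    "(\<^bold>\<exists>x. \<^bold>\<exists>y. (x \<^bold>\<in> A) \<^bold>\<and> (y \<^bold>\<in> check gset_omega) \<^bold>\<and> fPair z x y) p4"
    using fImp_obtains[OF graph p3(1) \<open>p3 \<le> p\<close> p3(4)] .
  obtain p5 x' where p5: "p5 \<noteq> bot" "p5 \<le> p4"
    "(\<^bold>\<exists>y. (x' \<^bold>\<in> A) \<^bold>\<and> (y \<^bold>\<in> check gset_omega) \<^bold>\<and> fPair z x' y) p5"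
    using fEx_obtains[OF p4(3,1)] .
  obtain p6 y' where "p6 \<noteq> bot" "p6 \<le> p5"
    "((x' \<^bold>\<in> A) \<^bold>\<and> (y' \<^bold>\<in> check gset_omega) \<^bold>\<and> fPair z x' y') p6"
    using fEx_obtains[OF p5(3,1)] .
  then have p6: "p6 \<noteq> bot" "p6 \<le> p5" "(y' \<^bold>\<in> check gset_omega) p6" "fPair z x' y' p6"
    unfolding fAnd_iff by simp_all
  have "p6 \<le> p3" using p4 p5 p6 by (meson order_trans)
  then obtain p7 where p7: "p7 \<noteq> bot" "p7 \<le> p6" "(y \<^bold>= y') p7"
    using fPair_inject_right[OF fPair_antimono[OF p3(3)] p6(4,1)] by blast
  have "(y' \<^bold>\<in> check gset_omega) p7" using p6 p7 fMem_antimono by blast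
  then obtain r n where r: "r \<noteq> bot" "r \<le> p7" "(y' \<^bold>= check (gset_nat n)) r"
    using p7(1) unfolding fMem_check_iff gset_elems_omega[OF assms(1)]
    by (blast elim: dense_below_obtains)
  have le: "r \<le> p2" using \<open>p6 \<le> p3\<close> p3 p7 r by (meson order_trans)
  show thesis
  proof (rule that)
    show "r \<noteq> bot" by fact
    show "r \<le> p" using le p1 p2 by (meson order_trans)
    show "fRel f x y r" using p2 le fRel_antimono by blast
    show "(y \<^bold>= check (gset_nat n)) r" using r p7 fEq_antimono fEq_trans by blast
  qed
qed

text \<open>A common extension of \<open>r s\<close> and \<open>r t\<close> would force both values
  to equal the same natural number, although \<open>s\<close> below \<open>t\<close> forces them to
  differ.\<close>

lemma fSpecial_check_incompatible:
  fixes c :: "'a \<Rightarrow> 'u gset" and p :: "'b :: boolean_algebra"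
  assumes inf: "infinite (UNIV :: 'u set)" and T: "T \<lesssim> (UNIV :: 'u set)"
    and p: "p \<noteq> bot"
    and sp: "fSpecial (check (gset_nodes T c)) (check (gset_order T lt c)) (check gset_omega) p"
  obtains r :: "'a \<Rightarrow> 'b" and n :: "'a \<Rightarrow> nat"
  where "\<And>t. t \<in> T \<Longrightarrow> r t \<noteq> bot"
    and "\<And>s t. s \<in> T \<Longrightarrow> t \<in> T \<Longrightarrow> lt s t \<Longrightarrow> n s = n t \<Longrightarrow> inf (r s) (r t) = bot"
proof -
  let ?T = "check (gset_nodes T c)" and ?R = "check (gset_order T lt c)"
  \<comment> \<open>Strengthening to \<open>q\<close> fixes one name \<open>f\<close>, so that the
    conditions chosen for different nodes speak of the same function.\<close>
  obtain f q where q: "q \<noteq> bot" "q \<le> p"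
    and "(fFun f ?T (check gset_omega) \<^bold>\<and>
      (\<^bold>\<forall>s. \<^bold>\<forall>t. \<^bold>\<forall>m. \<^bold>\<forall>n. (s \<^bold>\<in> ?T) \<^bold>\<and> (t \<^bold>\<in> ?T) \<^bold>\<and> fRel ?R s t \<^bold>\<and> fRel f s m \<^bold>\<and> fRel f t n
        \<^bold>\<longrightarrow> \<^bold>\<not> (m \<^bold>= n))) q"
    using fEx_obtains[OF sp[unfolded fSpecial_def] p] .
  then have f: "fFun f ?T (check gset_omega) q"
    and spec: "\<And>s t m n. ((s \<^bold>\<in> ?T) \<^bold>\<and> (t \<^bold>\<in> ?T) \<^bold>\<and> fRel ?R s t \<^bold>\<and> fRel f s m \<^bold>\<and> fRel f t n
        \<^bold>\<longrightarrow> \<^bold>\<not> (m \<^bold>= n)) q"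
    unfolding fAnd_iff fAll_iff by simp_all
  have mem: "(check (c t) \<^bold>\<in> ?T) u" if "t \<in> T" for t u
    using that T by (intro check_fMem_check) (simp add: gset_elems_nodes)
  have "\<exists>r n y. r \<noteq> bot \<and> r \<le> q \<and> fRel f (check (c t)) y r \<and> (y \<^bold>= check (gset_nat n)) r"
    if "t \<in> T" for t
    using fFun_check_omega_decide[OF inf f q(1) mem[OF that]] by metis
  then obtain r n y where r: "\<And>t. t \<in> T \<Longrightarrow> r t \<noteq> bot" "\<And>t. t \<in> T \<Longrightarrow> r t \<le> q"
      "\<And>t. t \<in> T \<Longrightarrow> fRel f (check (c t)) (y t) (r t)"
      "\<And>t. t \<in> T \<Longrightarrow> (y t \<^bold>= check (gset_nat (n t))) (r t)"
    by metis
  have incompatible: "inf (r s) (r t) = bot" if st: "s \<in> T" "t \<in> T" "lt s t" "n s = n t" for s t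
  proof (rule ccontr)
    let ?u = "inf (r s) (r t)"
    assume u: "?u \<noteq> bot"
    have le: "?u \<le> r s" "?u \<le> r t" by simp_all
    then have "?u \<le> q" using r(2) st by (meson order_trans)
    moreover have "((check (c s) \<^bold>\<in> ?T) \<^bold>\<and> (check (c t) \<^bold>\<in> ?T) \<^bold>\<and> fRel ?R (check (c s)) (check (c t))
        \<^bold>\<and> fRel f (check (c s)) (y s) \<^bold>\<and> fRel f (check (c t)) (y t)) ?u"
      unfolding fAnd_iff
      using mem st fRel_order_check[OF inf T] fRel_antimono[OF r(3)] le by blast
    ultimately obtain v where v: "v \<noteq> bot" "v \<le> ?u" "(\<^bold>\<not> (y s \<^bold>= y t)) v"
      using fImp_obtains[OF spec u] by blast
    have "(y s \<^bold>= y t) ?u"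
      using fEq_antimono[OF r(4) le(1)] fEq_antimono[OF r(4) le(2)] st fEq_trans fEq_sym by metis
    then have "(y s \<^bold>= y t) v" using v fEq_antimono by blast
    with v show False unfolding fNot_def by blast
  qed
  show thesis by (rule that[OF r(1) incompatible])
qed


section \<open>Strictly positive measures\<close>

lemma sum_disjoint_le:
  fixes m :: "'b :: boolean_algebra \<Rightarrow> real" and r :: "'a \<Rightarrow> 'b"
  assumes add: "\<And>a b. inf a b = bot \<Longrightarrow> m (sup a b) = m a + m b"
    and bound: "\<And>a. m a \<le> 1" and "finite S"
    and disj: "\<And>s t. s \<in> S \<Longrightarrow> t \<in> S \<Longrightarrow> s \<noteq> t \<Longrightarrow> inf (r s) (r t) = bot"
  shows "(\<Sum>s\<in>S. m (r s)) \<le> 1"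
proof -
  have "m bot = 0" using add[of bot bot] by simp
  \<comment> \<open>The witness \<open>u\<close> is the join of the \<open>r s\<close>. The second
    conjunct makes the next element disjoint from the join so far, as additivity requires.\<close>
  have "\<exists>u. m u = (\<Sum>s\<in>S. m (r s)) \<and> (\<forall>x. (\<forall>s\<in>S. inf x (r s) = bot) \<longrightarrow> inf x u = bot)"
    using \<open>finite S\<close> disj
  proof (induction S rule: finite_induct)
    case empty
    show ?case using \<open>m bot = 0\<close> by (intro exI[of _ bot]) simp
  next
    case (insert a S)
    then obtain u where u: "m u = (\<Sum>s\<in>S. m (r s))"
      "\<forall>x. (\<forall>s\<in>S. inf x (r s) = bot) \<longrightarrow> inf x u = bot" by (metis insertCI)
    have "inf (r a) u = bot" using u(2) insert by (metis insertCI)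
    then show ?case
      using insert.hyps u by (intro exI[of _ "sup (r a) u"]) (simp add: add inf_sup_distrib1)
  qed
  then show ?thesis using bound by metis
qed

text \<open>A pigeonhole argument on measure, valid for every strictly positive finitely additive
  \<open>m\<close> bounded by 1.\<close>

lemma special_if_incompatible:
  fixes m :: "'b :: boolean_algebra \<Rightarrow> real" and r :: "'a \<Rightarrow> 'b" and n :: "'a \<Rightarrow> nat"
  assumes tree: "is_tree T lt"
    and add: "\<And>a b. inf a b = bot \<Longrightarrow> m (sup a b) = m a + m b"
    and bound: "\<And>a. m a \<le> 1" and pos: "\<And>a. a \<noteq> bot \<Longrightarrow> 0 < m a"
    and r: "\<And>t. t \<in> T \<Longrightarrow> r t \<noteq> bot"
    and disj: "\<And>s t. s \<in> T \<Longrightarrow> t \<in> T \<Longrightarrow> lt s t \<Longrightarrow> n s = n t \<Longrightarrow> inf (r s) (r t) = bot"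
  shows "special T lt"
proof -
  \<comment> \<open>\<open>k\<close> is chosen with \<open>m (r t) > 1/k\<close>; this is where
    strict positivity enters.\<close>
  have "\<exists>k. 1 < real k * m (r t)" if "t \<in> T" for t
    using reals_Archimedean3[OF pos[OF r[OF that]]] by blast
  then obtain k where k: "\<And>t. t \<in> T \<Longrightarrow> 1 < real (k t) * m (r t)"
    by metis
  define P where "P t = {s \<in> T. lt s t \<and> n s = n t \<and> k s = k t}" for t
  \<comment> \<open>Predecessors of a node form a chain, so distinct members of \<open>P t\<close>
    are comparable and carry disjoint conditions.\<close>
  have linear: "s = s' \<or> lt s s' \<or> lt s' s" if "t \<in> T" "s \<in> P t" "s' \<in> P t" for s s' t
  proof -
    have "well_order_on (preds T lt t) (pred_order T lt t)"
      using tree that(1) unfolding is_tree_def by blast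
    then have "total_on (preds T lt t) (pred_order T lt t)"
      by (simp add: well_order_on_def linear_order_on_def)
    then show ?thesis
      using that unfolding total_on_def P_def preds_def pred_order_def by blast
  qed
  have fin: "finite (P t)" if t: "t \<in> T" for t
  proof (rule ccontr)
    assume "infinite (P t)"
    \<comment> \<open>Exactly \<open>k t\<close> disjoint conditions, each of measure above
      \<open>1 / k t\<close>, would have total measure above 1.\<close>
    then obtain S where S: "finite S" "card S = k t" "S \<subseteq> P t"
      using infinite_arbitrarily_large by blast
    have "inf (r s) (r s') = bot" if "s \<in> S" "s' \<in> S" "s \<noteq> s'" for s s'
    proof -
      have P: "s \<in> P t" "s' \<in> P t" using that S(3) by auto
      with linear[OF t] that have "lt s s' \<or> lt s' s" by blast
      with P show ?thesis
        using disj[of s s'] disj[of s' s] unfolding P_def by (auto simp: inf_commute[of "r s'"])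
    qed
    then have "(\<Sum>s\<in>S. m (r s)) \<le> 1"
      using add bound S(1) by (intro sum_disjoint_le) auto
    \<comment> \<open>\<open>k t = 0\<close> would give \<open>1 < 0\<close>. Hence \<open>S\<close>
      is nonempty and the sums compare strictly.\<close>
    have kpos: "0 < real (k t)" using k[OF t] by (cases "k t") auto
    then have "S \<noteq> {}" using S by auto
    moreover have "1 / real (k t) < m (r s)" if "s \<in> S" for s
      using k[of s] that S(3) kpos by (auto simp: P_def field_simps)
    ultimately have "(\<Sum>s\<in>S. 1 / real (k t)) < (\<Sum>s\<in>S. m (r s))"
      using S(1) by (intro sum_strict_mono) auto
    with S(2) kpos \<open>(\<Sum>s\<in>S. m (r s)) \<le> 1\<close> show False by simp
  qed
  define g where "g t = to_nat (n t, k t, card (P t))" for t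
  have "g s \<noteq> g t" if st: "s \<in> T" "t \<in> T" "lt s t" for s t
  proof
    assume "g s = g t"
    then have eq: "n s = n t" "k s = k t" "card (P s) = card (P t)" by (auto simp: g_def)
    have "transp_on T lt" "irreflp_on T lt" using tree by (auto simp: is_tree_def)
    \<comment> \<open>Within a class, \<open>P t\<close> contains \<open>P s\<close> and also
      \<open>s\<close>; finiteness turns this into a strict increase of cardinality.\<close>
    then have "P s \<subseteq> P t" "s \<in> P t" "s \<notin> P s"
      using st eq by (auto simp: P_def dest: transp_onD irreflp_onD)
    then have "card (P s) < card (P t)" using fin st by (intro psubset_card_mono) auto
    with eq show False by simp
  qed
  then show ?thesis unfolding special_def by blast
qed

section \<open>The strictly positive measure on the random algebra\<close>

lemma prob_space_coin_measure: "prob_space (coin_measure :: ('k \<Rightarrow> bool) measure)"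
  unfolding coin_measure_def by (intro prob_space_PiM measure_pmf.prob_space_axioms)

lift_definition random_measure :: "'k random_algebra \<Rightarrow> real" is "measure coin_measure"
  unfolding null_eq_AE by (auto intro!: measure_eq_AE)

lemma random_measure_le_1: "random_measure a \<le> 1"
  by transfer (rule prob_space.prob_le_1[OF prob_space_coin_measure])

text \<open>Disjointness in the quotient only makes the intersection of representatives null, so
  inclusion-exclusion is applied.\<close>

lemma random_measure_sup:
  "inf a b = bot \<Longrightarrow> random_measure (sup a b) = random_measure a + random_measure b"
proof (transfer, goal_cases)
  case (1 A B)
  interpret prob_space "coin_measure :: ('a \<Rightarrow> bool) measure" by (rule prob_space_coin_measure)
  from 1 have "A \<in> sets coin_measure" "B \<in> sets coin_measure" "A \<inter> B \<in> null_sets coin_measure"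
    by (auto simp: null_eq_def)
  then show ?case
    by (simp add: measure_Un3 fmeasurable_eq_sets measure_eq_0_null_sets)
qed

text \<open>The zero class consists exactly of the null sets.\<close>

lemma random_measure_pos: "a \<noteq> bot \<Longrightarrow> 0 < random_measure a"
proof (transfer, goal_cases)
  case (1 A)
  interpret prob_space "coin_measure :: ('a \<Rightarrow> bool) measure" by (rule prob_space_coin_measure)
  from 1 have "A \<in> sets coin_measure" "A \<notin> null_sets coin_measure"
    by (auto simp: null_eq_def)
  then show ?case by (auto simp: null_sets_def emeasure_eq_measure zero_less_measure_iff)
qed

theorem corollary3p5:
  fixes T :: "'a set"
    and lt :: "'a \<Rightarrow> 'a \<Rightarrow> bool"
    and c :: "'a \<Rightarrow> 'u gset"
  assumes "infinite (UNIV :: 'k set)"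
    and "is_tree T lt"
    and "height_omega1 T lt"
    and "\<nexists>b. cofinal_branch T lt b"
    and "\<not> special T lt"
    and "gset_coding T c"
  shows "forced_nonspecial TYPE('k random_algebra) T lt c"
proof (rule ccontr)
  assume "\<not> ?thesis"
  \<comment> \<open>Some condition fails to force the negation, so a nonzero \<open>p\<close> below
    it forces specialness.\<close>
  then obtain p :: "'k random_algebra" where p: "p \<noteq> bot"
    "fSpecial (check (gset_nodes T c)) (check (gset_order T lt c)) (check gset_omega) p"
    unfolding forced_nonspecial_def forced_def fNot_def[of "fSpecial _ _ _"] by blast
  have T: "T \<lesssim> (UNIV :: 'u set)"
    using assms(6) by (simp add: gset_coding_def)
  \<comment> \<open>An injection of a finite \<open>T\<close> into the naturals would specialize it.
    Infinity of \<open>T\<close> passes to \<open>'u\<close>, as the coding of pairs and omega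
    requires.\<close>
  have "infinite T"
  proof
    assume "finite T"
    then obtain f :: "'a \<Rightarrow> nat" where "inj_on f T"
      using countable_finite unfolding countable_def by blast
    then have "special T lt"
      using assms(2) unfolding special_def is_tree_def by (metis inj_onD irreflp_onD)
    with assms(5) show False by contradiction
  qed
  then have "infinite (UNIV :: 'u set)"
    using T unfolding infinite_le_lepoll by (rule lepoll_trans)
  then obtain r :: "'a \<Rightarrow> 'k random_algebra" and n :: "'a \<Rightarrow> nat"
    where r: "\<And>t. t \<in> T \<Longrightarrow> r t \<noteq> bot"
      "\<And>s t. s \<in> T \<Longrightarrow> t \<in> T \<Longrightarrow> lt s t \<Longrightarrow> n s = n t \<Longrightarrow> inf (r s) (r t) = bot"
    using fSpecial_check_incompatible[OF _ T p] by metis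
  have "special T lt"
    by (rule special_if_incompatible[where m = random_measure and r = r and n = n])
      (fact assms(2) random_measure_sup random_measure_le_1 random_measure_pos r)+
  with assms(5) show False by contradiction
qed

end
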